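(* Let $X$ be a hereditary class of graphs. If the set of bipartite graphs in $X$ is well-quasi-ordered by the labelled induced subgraph relation, then so is the set of curious graphs in $X$. If the set of bipartite graphs in $X$ has bounded clique-width, then so does the set of curious graphs in $X$.
   Context: All graphs are finite and simple. A class is hereditary if closed under taking induced subgraphs. A graph $G$ is curious if its vertex set can be partitioned into three (possibly empty) independent sets $V_1,V_2,V_3$ such that there are no vertices $x\in V_1$, $y\in V_2$, $z\in V_3$ with $G[\{x,y,z\}]$ being a triangle $K_3$ or an edgeless graph $3P_1$ (i.e. no "rainbow" $K_3$ or $3P_1$). A class has bounded clique-width if there is a constant bounding the clique-width of all its members. Labelled graphs: given a quasi-order $(W,\le)$, a labelled graph is a graph $G$ with a map $l_G:V(G)\to W$; $G$ is a labelled induced subgraph of $H$ if there is an isomorphism from $G$ onto an induced subgraph of $H$ mapping each $v$ to some $w$ with $l_G(v)\le l_H(w)$. A class is well-quasi-ordered by the labelled induced subgraph relation if for every well-quasi-order $(W,\le)$ there is no infinite antichain of graphs of the class labelled by $W$ under this relation. *)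

theory Defs
  imports
    "HOL-Library.Countable_Set"
    "Graph_Theory.Pair_Digraph"
    "Graph_Theory.Digraph_Component"
begin

(* A finite simple graph is a symmetric loop-free finite digraph without parallel arcs: the
   locale predicate pair_graph of Graph_Theory.  The edge uv is the pair of arcs (u,v), (v,u). *)

definition graph_iso :: "('a \<Rightarrow> 'a) \<Rightarrow> 'a pair_pre_digraph \<Rightarrow> 'a pair_pre_digraph \<Rightarrow> bool" where
  "graph_iso f G H \<longleftrightarrow> bij_betw f (pverts G) (pverts H) \<and>
     (\<forall>u\<in>pverts G. \<forall>v\<in>pverts G. (u, v) \<in> parcs G \<longleftrightarrow> (f u, f v) \<in> parcs H)"

(* As usual, classes of graphs do not distinguish isomorphic graphs.  All vertices come from one
   type; every finite graph is isomorphic to a graph on any given infinite vertex type. *)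
definition graph_class :: "'a pair_pre_digraph set \<Rightarrow> bool" where
  "graph_class X \<longleftrightarrow> (\<forall>G\<in>X. pair_graph G) \<and>
     (\<forall>G\<in>X. \<forall>H. pair_graph H \<longrightarrow> (\<exists>f. graph_iso f G H) \<longrightarrow> H \<in> X)"

definition hereditary :: "'a pair_pre_digraph set \<Rightarrow> bool" where
  "hereditary X \<longleftrightarrow>
     (\<forall>G\<in>X. \<forall>H. induced_subgraph (with_proj H) (with_proj G) \<longrightarrow> H \<in> X)"

definition independent_set :: "'a pair_pre_digraph \<Rightarrow> 'a set \<Rightarrow> bool" where
  "independent_set G S \<longleftrightarrow> S \<subseteq> pverts G \<and> (\<forall>u\<in>S. \<forall>v\<in>S. (u, v) \<notin> parcs G)"

definition bipartite :: "'a pair_pre_digraph \<Rightarrow> bool" where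
  "bipartite G \<longleftrightarrow> (\<exists>V1 V2. independent_set G V1 \<and> independent_set G V2 \<and>
     V1 \<inter> V2 = {} \<and> V1 \<union> V2 = pverts G)"

definition curious :: "'a pair_pre_digraph \<Rightarrow> bool" where
  "curious G \<longleftrightarrow> (\<exists>V1 V2 V3.
     independent_set G V1 \<and> independent_set G V2 \<and> independent_set G V3 \<and>
     V1 \<inter> V2 = {} \<and> V1 \<inter> V3 = {} \<and> V2 \<inter> V3 = {} \<and> V1 \<union> V2 \<union> V3 = pverts G \<and>
     \<not> (\<exists>x\<in>V1. \<exists>y\<in>V2. \<exists>z\<in>V3.
          ((x, y) \<in> parcs G \<and> (y, z) \<in> parcs G \<and> (x, z) \<in> parcs G) \<or>
          ((x, y) \<notin> parcs G \<and> (y, z) \<notin> parcs G \<and> (x, z) \<notin> parcs G)))"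


section \<open>Labelled graphs and well-quasi-orders\<close>

definition wqo_on :: "'w set \<Rightarrow> ('w \<Rightarrow> 'w \<Rightarrow> bool) \<Rightarrow> bool" where
  "wqo_on W le \<longleftrightarrow> reflp_on W le \<and> transp_on W le \<and>
     (\<forall>f :: nat \<Rightarrow> 'w. range f \<subseteq> W \<longrightarrow> (\<exists>i j. i < j \<and> le (f i) (f j)))"

(* A labelled graph is a pair (G, l).  Only the values of l on the vertices of G matter: pairs
   differing elsewhere are related both ways below, so they never lie in a common antichain. *)
type_synonym ('a, 'w) labelled_graph = "'a pair_pre_digraph \<times> ('a \<Rightarrow> 'w)"

definition labelled_induced_subgraph ::
  "('w \<Rightarrow> 'w \<Rightarrow> bool) \<Rightarrow> ('a, 'w) labelled_graph \<Rightarrow> ('a, 'w) labelled_graph \<Rightarrow> bool" where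
  "labelled_induced_subgraph le p q \<longleftrightarrow> (case (p, q) of ((G, l), (H, m)) \<Rightarrow>
     \<exists>H' f. induced_subgraph (with_proj H') (with_proj H) \<and> graph_iso f G H' \<and>
       (\<forall>v\<in>pverts G. le (l v) (m (f v))))"

(* HOL cannot quantify over all label types inside a formula, so the label type is a parameter.
   The type nat already gives the full strength: see labelled_wqo_nat_imp below. *)
definition labelled_wqo :: "'w itself \<Rightarrow> 'a pair_pre_digraph set \<Rightarrow> bool" where
  "labelled_wqo _ C \<longleftrightarrow> (\<forall>(W :: 'w set) le. wqo_on W le \<longrightarrow>
     \<not> (\<exists>A :: ('a, 'w) labelled_graph set. infinite A \<and>
          (\<forall>(G, l)\<in>A. G \<in> C \<and> l ` pverts G \<subseteq> W) \<and>
          pairwise (\<lambda>p q. \<not> labelled_induced_subgraph le p q) A))"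


section \<open>Clique-width\<close>

(* cw_construct k G l: the graph G with its vertices labelled by l arises from the four
   clique-width operations using only labels below k. *)
inductive cw_construct :: "nat \<Rightarrow> 'a pair_pre_digraph \<Rightarrow> ('a \<Rightarrow> nat) \<Rightarrow> bool" for k where
  new_vertex: "i < k \<Longrightarrow> cw_construct k \<lparr>pverts = {v}, parcs = {}\<rparr> (\<lambda>_. i)"
| disjoint_union: "cw_construct k G l \<Longrightarrow> cw_construct k H m \<Longrightarrow> pverts G \<inter> pverts H = {} \<Longrightarrow>
    cw_construct k \<lparr>pverts = pverts G \<union> pverts H, parcs = parcs G \<union> parcs H\<rparr>
      (\<lambda>v. if v \<in> pverts G then l v else m v)"
| join: "cw_construct k G l \<Longrightarrow> i < k \<Longrightarrow> j < k \<Longrightarrow> i \<noteq> j \<Longrightarrow>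
    cw_construct k \<lparr>pverts = pverts G, parcs = parcs G \<union>
      {(u, v). u \<in> pverts G \<and> v \<in> pverts G \<and> (l u = i \<and> l v = j \<or> l u = j \<and> l v = i)}\<rparr> l"
| relabel: "cw_construct k G l \<Longrightarrow> i < k \<Longrightarrow> j < k \<Longrightarrow>
    cw_construct k G (\<lambda>v. if l v = i then j else l v)"

(* The operations never produce the graph without vertices. *)
definition clique_width :: "'a pair_pre_digraph \<Rightarrow> nat" where
  "clique_width G = (if pverts G = {} then 0 else LEAST k. \<exists>l. cw_construct k G l)"

definition bounded_clique_width :: "'a pair_pre_digraph set \<Rightarrow> bool" where
  "bounded_clique_width C \<longleftrightarrow> (\<exists>k. \<forall>G\<in>C. clique_width G \<le> k)"


section \<open>Adequacy of the definitions\<close>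

lemma induced_subgraph_with_proj:
  assumes "pair_graph G"
  shows "induced_subgraph (with_proj H) (with_proj G) \<longleftrightarrow>
    pverts H \<subseteq> pverts G \<and> parcs H = parcs G \<inter> (pverts H \<times> pverts H)"
proof -
  have G: "pair_wf_digraph G"
    using assms by (simp add: pair_graph_def pair_digraph_def pair_fin_digraph_def)
  show ?thesis
  proof
    assume "induced_subgraph (with_proj H) (with_proj G)"
    then show "pverts H \<subseteq> pverts G \<and> parcs H = parcs G \<inter> (pverts H \<times> pverts H)"
      unfolding induced_subgraph_def subgraph_def with_proj_simps by force
  next
    assume H: "pverts H \<subseteq> pverts G \<and> parcs H = parcs G \<inter> (pverts H \<times> pverts H)"
    then have "pair_wf_digraph H"
      by (auto simp: pair_wf_digraph_def)
    with G H show "induced_subgraph (with_proj H) (with_proj G)"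
      unfolding induced_subgraph_def subgraph_def compatible_def wf_digraph_wp_iff with_proj_simps
      by force
  qed
qed

lemma labelled_induced_subgraph_iff:
  assumes "pair_graph H"
  shows "labelled_induced_subgraph le (G, l) (H, m) \<longleftrightarrow>
    (\<exists>f. inj_on f (pverts G) \<and> f ` pverts G \<subseteq> pverts H \<and>
      (\<forall>u\<in>pverts G. \<forall>v\<in>pverts G. (u, v) \<in> parcs G \<longleftrightarrow> (f u, f v) \<in> parcs H) \<and>
      (\<forall>v\<in>pverts G. le (l v) (m (f v))))"
    (is "?L \<longleftrightarrow> (\<exists>f. ?R f)")
proof
  assume ?L
  then obtain H' f where H': "pverts H' \<subseteq> pverts H" "parcs H' = parcs H \<inter> (pverts H' \<times> pverts H')"
    and f: "graph_iso f G H'" "\<forall>v\<in>pverts G. le (l v) (m (f v))"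
    unfolding labelled_induced_subgraph_def prod.case induced_subgraph_with_proj[OF assms] by blast
  have im: "inj_on f (pverts G)" "f ` pverts G = pverts H'"
    using f(1) by (auto simp: graph_iso_def bij_betw_def)
  moreover have "(u, v) \<in> parcs G \<longleftrightarrow> (f u, f v) \<in> parcs H"
    if "u \<in> pverts G" "v \<in> pverts G" for u v
  proof -
    have "(f u, f v) \<in> pverts H' \<times> pverts H'" using that im by blast
    then show ?thesis using that f(1) H'(2) unfolding graph_iso_def by blast
  qed
  ultimately have "?R f" using H'(1) f(2) by blast
  then show "\<exists>f. ?R f" by blast
next
  assume "\<exists>f. ?R f"
  then obtain f where f: "?R f" ..
  let ?H = "\<lparr>pverts = f ` pverts G, parcs = parcs H \<inter> (f ` pverts G \<times> f ` pverts G)\<rparr>"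
  have "induced_subgraph (with_proj ?H) (with_proj H)"
    using f by (subst induced_subgraph_with_proj[OF assms]) auto
  moreover have "graph_iso f G ?H"
    using f by (auto simp: graph_iso_def bij_betw_def)
  ultimately show ?L
    using f unfolding labelled_induced_subgraph_def prod.case by blast
qed

lemma labelled_wqo_nat_imp:
  fixes C :: "'a pair_pre_digraph set"
  assumes C: "\<forall>G\<in>C. pair_graph G" and nat: "labelled_wqo TYPE(nat) C"
  shows "labelled_wqo TYPE('w) C"
  unfolding labelled_wqo_def
proof (intro allI impI notI)
  fix W :: "'w set" and le
  assume wqo: "wqo_on W le"
  assume "\<exists>A :: ('a, 'w) labelled_graph set. infinite A \<and>
    (\<forall>(G, l)\<in>A. G \<in> C \<and> l ` pverts G \<subseteq> W) \<and>
    pairwise (\<lambda>p q. \<not> labelled_induced_subgraph le p q) A"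
  then obtain A :: "('a, 'w) labelled_graph set" where A: "infinite A"
    "\<forall>(G, l)\<in>A. G \<in> C \<and> l ` pverts G \<subseteq> W"
    "pairwise (\<lambda>p q. \<not> labelled_induced_subgraph le p q) A"
    by blast
  have finC: "finite (pverts G)" if "(G, l) \<in> A" for G l
    using that A(2) C by (auto dest!: bspec intro: pair_fin_digraph.pair_finite_verts
      simp: pair_graph_def pair_digraph_def)
  obtain B where B: "B \<subseteq> A" "infinite B" "countable B"
    using A(1) by (metis infinite_countable_subset')
  define U where "U = (\<Union>(G, l)\<in>B. l ` pverts G)"
  have "countable U"
    unfolding U_def using B finC by (intro countable_UN) (auto intro!: countable_finite)
  have U_W: "U \<subseteq> W" unfolding U_def using B A(2) by fast
  define h where "h = to_nat_on U"
  have h: "inj_on h U" unfolding h_def using \<open>countable U\<close> by (rule inj_on_to_nat_on)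
  define g where "g = inv_into U h"
  have gh: "g (h x) = x" if "x \<in> U" for x
    unfolding g_def using h that by simp
  define le' where "le' x y = le (g x) (g y)" for x y
  have g_U: "g x \<in> U" if "x \<in> h ` U" for x
    using that gh by auto
  have wqo': "wqo_on (h ` U) le'"
    unfolding wqo_on_def
  proof (intro conjI allI impI)
    show "reflp_on (h ` U) le'"
      using wqo U_W g_U unfolding wqo_on_def reflp_on_def le'_def by blast
    show "transp_on (h ` U) le'"
      using wqo U_W g_U unfolding wqo_on_def transp_on_def le'_def by (meson subsetD)
    fix f :: "nat \<Rightarrow> nat"
    assume "range f \<subseteq> h ` U"
    then have "range (g \<circ> f) \<subseteq> W" using g_U U_W by fastforce
    then show "\<exists>i j. i < j \<and> le' (f i) (f j)"
      using wqo unfolding wqo_on_def le'_def comp_def by blast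
  qed
  define F where "F p = (fst p, h \<circ> snd p)" for p :: "('a, 'w) labelled_graph"
  have lU: "l v \<in> U" if "(G, l) \<in> B" "v \<in> pverts G" for G l v
    using that unfolding U_def by blast
  have F_iff: "labelled_induced_subgraph le p q"
    if pq: "p \<in> B" "q \<in> B" and "labelled_induced_subgraph le' (F p) (F q)" for p q
  proof -
    obtain G l H m where [simp]: "p = (G, l)" "q = (H, m)" by (cases p, cases q)
    have H: "pair_graph H" using pq B(1) A(2) C by fastforce
    show ?thesis
      using that lU[of G l] lU[of H m]
      unfolding F_def \<open>p = _\<close> \<open>q = _\<close> fst_conv snd_conv labelled_induced_subgraph_iff[OF H]
      by (fastforce simp: le'_def gh image_subset_iff)
  qed
  have F_refl: "labelled_induced_subgraph le' (F p) (F p)" if "p \<in> B" for p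
  proof -
    obtain G l where [simp]: "p = (G, l)" by (cases p)
    have G: "pair_graph G" using that B(1) A(2) C by fastforce
    show ?thesis
      unfolding F_def \<open>p = _\<close> fst_conv snd_conv labelled_induced_subgraph_iff[OF G]
      using that lU wqo' by (intro exI[of _ id]) (auto simp: wqo_on_def reflp_on_def)
  qed
  have anti: "\<not> labelled_induced_subgraph le' (F p) (F q)" if "p \<in> B" "q \<in> B" "p \<noteq> q" for p q
    using that F_iff A(3) B(1) unfolding pairwise_def by blast
  have "inj_on F B"
    using anti F_refl by (metis inj_onI)
  then have "infinite (F ` B)" using B(2) finite_imageD by blast
  moreover have "\<forall>(G, l)\<in>F ` B. G \<in> C \<and> l ` pverts G \<subseteq> h ` U"
    using A(2) B(1) lU by (fastforce simp: F_def)
  moreover have "pairwise (\<lambda>p q. \<not> labelled_induced_subgraph le' p q) (F ` B)"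
    using anti by (auto simp: pairwise_def)
  ultimately show False
    using nat wqo' unfolding labelled_wqo_def by blast
qed

lemma ex_cw_construct:
  assumes "pair_graph G" "pverts G \<noteq> {}"
  shows "\<exists>l. cw_construct (card (pverts G)) G l"
proof -
  interpret pair_graph G by fact
  let ?V = "pverts G" and ?k = "card (pverts G)"
  obtain h where h: "bij_betw h ?V {..<?k}"
    using ex_bij_betw_finite_nat[OF pair_finite_verts] by (metis atLeast0LessThan)
  have hk: "h v < ?k" if "v \<in> ?V" for v
    using h that by (auto simp: bij_betw_def)
  have h_inj: "u = v" if "h u = h v" "u \<in> ?V" "v \<in> ?V" for u v
    using h that by (auto simp: bij_betw_def inj_on_def)
  have "\<exists>l. cw_construct ?k \<lparr>pverts = S, parcs = {}\<rparr> l \<and> (\<forall>v\<in>S. l v = h v)"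
    if "finite S" "S \<noteq> {}" "S \<subseteq> ?V" for S
    using that
  proof (induction S rule: finite_ne_induct)
    case (singleton v)
    then show ?case using new_vertex[OF hk[of v], of v] by auto
  next
    case (insert v S)
    then obtain l where l: "cw_construct ?k \<lparr>pverts = S, parcs = {}\<rparr> l" "\<forall>u\<in>S. l u = h u"
      by auto
    have "cw_construct ?k \<lparr>pverts = {v}, parcs = {}\<rparr> (\<lambda>_. h v)"
      using insert.prems by (intro new_vertex hk) simp
    from disjoint_union[OF this l(1)] insert.hyps
    have "cw_construct ?k \<lparr>pverts = insert v S, parcs = {}\<rparr> (\<lambda>u. if u \<in> {v} then h v else l u)"
      by simp
    then show ?case using l(2) by (intro exI conjI) auto
  qed
  from this[OF pair_finite_verts assms(2)] obtain l where
    l: "cw_construct ?k \<lparr>pverts = ?V, parcs = {}\<rparr> l" "\<forall>v\<in>?V. l v = h v"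
    by auto
  have "cw_construct ?k \<lparr>pverts = ?V, parcs = F \<union> F\<inverse>\<rparr> l" if "finite F" "F \<subseteq> parcs G" for F
    using that
  proof (induction F rule: finite_induct)
    case empty
    then show ?case using l by simp
  next
    case (insert e F)
    obtain u v where e: "e = (u, v)" by (cases e)
    have uv: "u \<in> ?V" "v \<in> ?V" "u \<noteq> v"
      using insert.prems e wellformed' no_loops' by auto
    have "l u < ?k" "l v < ?k"
      using uv l(2) hk by simp_all
    moreover have "l u \<noteq> l v"
      using uv l(2) h_inj[of u v] by auto
    moreover have "cw_construct ?k \<lparr>pverts = ?V, parcs = F \<union> F\<inverse>\<rparr> l"
      using insert by auto
    ultimately have "cw_construct ?k \<lparr>pverts = ?V, parcs = F \<union> F\<inverse> \<union>
      {(x, y). x \<in> ?V \<and> y \<in> ?V \<and> (l x = l u \<and> l y = l v \<or> l x = l v \<and> l y = l u)}\<rparr> l"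
      using join by fastforce
    moreover have "{(x, y). x \<in> ?V \<and> y \<in> ?V \<and> (l x = l u \<and> l y = l v \<or> l x = l v \<and> l y = l u)}
      = {(u, v), (v, u)}"
      using uv l(2) h_inj by auto
    moreover have "F \<union> F\<inverse> \<union> {(u, v), (v, u)} = insert e F \<union> (insert e F)\<inverse>"
      using e by auto
    ultimately show ?case by simp
  qed
  from this[OF pair_finite_arcs] have "cw_construct ?k \<lparr>pverts = ?V, parcs = parcs G \<union> (parcs G)\<inverse>\<rparr> l"
    by simp
  moreover have "\<lparr>pverts = ?V, parcs = parcs G \<union> (parcs G)\<inverse>\<rparr> = G"
    using arcs_symmetric by (auto intro!: pair_pre_digraph.equality)
  ultimately show ?thesis by auto
qed

end

theory Submission
  imports Defs "HOL-Library.Sublist" "HOL-Library.Infinite_Set"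
begin

text \<open>A curious partition turns the graph into a tripartite tournament: for \<open>u\<close> in a part and \<open>v\<close> in
  the cyclically next one, orient the pair from \<open>v\<close> to \<open>u\<close> if they are adjacent and from \<open>u\<close> to \<open>v\<close>
  otherwise.  The rainbow \<open>K\<^sub>3\<close> and \<open>3P\<^sub>1\<close> are then the two directed rainbow triangles, and their absence
  forces every strong component to meet at most two parts.  So the vertex set is a sequence of slices
  inducing bipartite graphs of the class, and adjacency between different slices depends only on their
  order and on the parts.  Higman's lemma applied to these sequences gives the statement on
  well-quasi-orders; adding the slices one at a time, with three labels for what was built before,
  gives the bound on clique-width.\<close>

section \<open>Well-quasi-orders\<close>

lemma wqo_on_refl: "wqo_on W le \<Longrightarrow> x \<in> W \<Longrightarrow> le x x"
  by (simp add: wqo_on_def reflp_on_def)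

lemma wqo_on_trans:
  "wqo_on W le \<Longrightarrow> le x y \<Longrightarrow> le y z \<Longrightarrow> x \<in> W \<Longrightarrow> y \<in> W \<Longrightarrow> z \<in> W \<Longrightarrow> le x z"
  unfolding wqo_on_def by (meson transp_onD)

lemma wqo_onE:
  assumes "wqo_on W le" "\<And>i. f i \<in> W"
  obtains i j :: nat where "i < j" "le (f i) (f j)"
  using assms unfolding wqo_on_def by blast

lemma wqo_onI:
  assumes "\<And>x. x \<in> W \<Longrightarrow> le x x"
    and "\<And>x y z. x \<in> W \<Longrightarrow> y \<in> W \<Longrightarrow> z \<in> W \<Longrightarrow> le x y \<Longrightarrow> le y z \<Longrightarrow> le x z"
    and "\<And>f :: nat \<Rightarrow> 'w. (\<And>i. f i \<in> W) \<Longrightarrow> (\<And>i j. i < j \<Longrightarrow> \<not> le (f i) (f j)) \<Longrightarrow> False"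
  shows "wqo_on W le"
  unfolding wqo_on_def
proof (intro conjI allI impI)
  show "reflp_on W le" using assms(1) by (simp add: reflp_on_def)
  show "transp_on W le" by (rule transp_onI) (rule assms(2))
  fix f :: "nat \<Rightarrow> 'w" assume "range f \<subseteq> W"
  then have f: "f i \<in> W" for i by blast
  show "\<exists>i j. i < j \<and> le (f i) (f j)"
  proof (rule ccontr)
    assume "\<nexists>i j. i < j \<and> le (f i) (f j)"
    then have "\<not> le (f i) (f j)" if "i < j" for i j using that by blast
    then show False by (rule assms(3)[OF f])
  qed
qed

text \<open>Only finitely many indices are terminal, meaning that no later element lies above; past the
  last one, the subsequence can be chosen greedily.\<close>

lemma wqo_on_monotone_subsequence:
  fixes f :: "nat \<Rightarrow> 'w"
  assumes wqo: "wqo_on W le" and f: "\<And>i. f i \<in> W"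
  obtains \<phi> :: "nat \<Rightarrow> nat"
  where "strict_mono \<phi>" "\<And>i j. i < j \<Longrightarrow> le (f (\<phi> i)) (f (\<phi> j))"
proof -
  define T where "T = {i. \<forall>j>i. \<not> le (f i) (f j)}"
  \<comment> \<open>Enumerated in increasing order, an infinite \<open>T\<close> would give a bad
    sequence.\<close>
  have "finite T"
  proof (rule ccontr)
    assume inf: "infinite T"
    obtain i j where ij: "i < j" "le (f (enumerate T i)) (f (enumerate T j))"
      using wqo_onE[OF wqo, of "\<lambda>i. f (enumerate T i)"] f by blast
    moreover have "enumerate T i \<in> T" using inf by (rule enumerate_in_set)
    ultimately show False using enumerate_mono[OF ij(1) inf] by (auto simp: T_def)
  qed
  then obtain N where N: "\<forall>i\<in>T. i < N" using finite_nat_set_iff_bounded by blast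
  have step: "\<exists>j. (N \<le> j) \<and> (i < j \<and> le (f i) (f j))" if "N \<le> i" for i
  proof -
    have "i \<notin> T" using N that by auto
    then obtain j where "i < j" "le (f i) (f j)" by (auto simp: T_def)
    then show ?thesis using that by (intro exI[of _ j]) simp
  qed
  obtain \<phi> where \<phi>: "\<And>n::nat. N \<le> \<phi> n" "\<And>n. \<phi> n < \<phi> (Suc n) \<and> le (f (\<phi> n)) (f (\<phi> (Suc n)))"
    using dependent_nat_choice[of "\<lambda>_ i. N \<le> i" "\<lambda>_ i j. i < j \<and> le (f i) (f j)"] step by blast
  have "le (f (\<phi> i)) (f (\<phi> j))" if "i < j" for i j
    using that
  proof (induction rule: less_Suc_induct)
    case (1 i) then show ?case using \<phi>(2) by blast
  next
    case (2 i j k) then show ?case using wqo_on_trans[OF wqo] f by blast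
  qed
  moreover have "strict_mono \<phi>" using \<phi>(2) by (simp add: strict_mono_Suc_iff)
  ultimately show thesis using that by blast
qed

text \<open>Pass to a subsequence on which the first components increase; two terms of it that are
  good in the second component are good in both.\<close>

lemma wqo_on_Times:
  assumes P: "wqo_on A P" and Q: "wqo_on B Q"
  shows "wqo_on (A \<times> B) (\<lambda>x y. P (fst x) (fst y) \<and> Q (snd x) (snd y))"
proof (rule wqo_onI)
  fix f :: "nat \<Rightarrow> 'a \<times> 'b"
  assume f: "\<And>i. f i \<in> A \<times> B"
    and bad: "\<And>i j. i < j \<Longrightarrow> \<not> (P (fst (f i)) (fst (f j)) \<and> Q (snd (f i)) (snd (f j)))"
  have f1: "fst (f i) \<in> A" and f2: "snd (f i) \<in> B" for i using f[of i] by (auto simp: mem_Times_iff)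
  obtain \<phi> :: "nat \<Rightarrow> nat" where \<phi>: "strict_mono \<phi>"
    "\<And>i j. i < j \<Longrightarrow> P (fst (f (\<phi> i))) (fst (f (\<phi> j)))"
    using wqo_on_monotone_subsequence[OF P, of "\<lambda>i. fst (f i)"] f1 by blast
  obtain i j where "i < j" "Q (snd (f (\<phi> i))) (snd (f (\<phi> j)))"
    using wqo_onE[OF Q, of "\<lambda>i. snd (f (\<phi> i))"] f2 by blast
  then show False using \<phi> bad[of "\<phi> i" "\<phi> j"] by (auto simp: strict_mono_less)
next
  fix x assume "x \<in> A \<times> B"
  then show "P (fst x) (fst x) \<and> Q (snd x) (snd x)"
    using wqo_on_refl[OF P] wqo_on_refl[OF Q] by auto
next
  fix x y z
  assume "x \<in> A \<times> B" "y \<in> A \<times> B" "z \<in> A \<times> B"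
    "P (fst x) (fst y) \<and> Q (snd x) (snd y)" "P (fst y) (fst z) \<and> Q (snd y) (snd z)"
  then show "P (fst x) (fst z) \<and> Q (snd x) (snd z)"
    using wqo_on_trans[OF P, of "fst x" "fst y" "fst z"]
      wqo_on_trans[OF Q, of "snd x" "snd y" "snd z"] by (auto simp: mem_Times_iff)
qed

lemma wqo_on_finite_eq:
  assumes "finite S" shows "wqo_on S (=)"
proof (rule wqo_onI)
  fix f :: "nat \<Rightarrow> 'a"
  assume f: "\<And>i. f i \<in> S" and bad: "\<And>i j. i < j \<Longrightarrow> f i \<noteq> f j"
  have "inj f" using bad by (metis injI linorder_neqE_nat)
  moreover have "finite (range f)" using f assms by (meson finite_subset image_subsetI)
  ultimately show False using finite_imageD by blast
qed auto

lemma wqo_on_nat: "wqo_on UNIV ((\<le>) :: nat \<Rightarrow> nat \<Rightarrow> bool)"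
proof (rule wqo_onI)
  fix f :: "nat \<Rightarrow> nat" assume bad: "\<And>i j. i < j \<Longrightarrow> \<not> f i \<le> f j"
  obtain i where "\<forall>j. f i \<le> f j" using ex_has_least_nat[of "\<lambda>_. True" _ f] by auto
  then show False using bad[of i "Suc i"] by auto
qed auto

text \<open>Higman's lemma, by Nash-Williams' minimal bad sequence argument.\<close>

theorem wqo_on_list_emb:
  fixes P :: "'b \<Rightarrow> 'b \<Rightarrow> bool"
  assumes wqo: "wqo_on A P"
  shows "wqo_on (lists A) (list_emb P)"
proof (rule wqo_onI)
  fix xs assume "xs \<in> lists A"
  then show "list_emb P xs xs" using wqo_on_refl[OF wqo] by (auto intro: list_emb_refl)
next
  fix xs ys zs assume "xs \<in> lists A" "ys \<in> lists A" "zs \<in> lists A" "list_emb P xs ys" "list_emb P ys zs"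
  then show "list_emb P xs zs"
    using wqo_on_trans[OF wqo] by (intro list_emb_trans[of xs ys zs]) (auto simp: in_lists_conv_set)
next
  define bad where "bad s \<longleftrightarrow> (\<forall>i. s i \<in> lists A) \<and> (\<forall>i j. i < j \<longrightarrow> \<not> list_emb P (s i) (s j))"
    for s :: "nat \<Rightarrow> 'b list"
  define minimal where "minimal n s \<longleftrightarrow> bad s \<and>
    (\<forall>t. bad t \<longrightarrow> (\<forall>i<n. t i = s i) \<longrightarrow> length (s n) \<le> length (t n))" for n s
  fix f :: "nat \<Rightarrow> 'b list"
  assume "\<And>i. f i \<in> lists A" "\<And>i j. i < j \<Longrightarrow> \<not> list_emb P (f i) (f j)"
  then have f: "bad f" by (auto simp: bad_def)
  have improve: "\<exists>t. minimal n t \<and> (\<forall>i<n. t i = s i)" if s: "bad s" for s n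
  proof -
    obtain t where "bad t \<and> (\<forall>i<n. t i = s i)"
      "\<forall>u. bad u \<and> (\<forall>i<n. u i = s i) \<longrightarrow> length (t n) \<le> length (u n)"
      using ex_has_least_nat[of "\<lambda>t. bad t \<and> (\<forall>i<n. t i = s i)" s "\<lambda>t. length (t n)"] s
      by blast
    then show ?thesis unfolding minimal_def by (intro exI[of _ t]) simp
  qed
  \<comment> \<open>Each choice keeps the terms up to index \<open>n\<close> and takes a bad
    sequence whose next term is as short as possible. The diagonal \<open>g\<close> of these
    sequences is the minimal bad sequence.\<close>
  have "\<exists>s. \<forall>n. minimal n (s n) \<and> (\<forall>i<Suc n. s (Suc n) i = s n i)"
  proof (rule dependent_nat_choice)
    show "\<exists>x. minimal 0 x" using improve[OF f] by blast
    show "\<exists>y. minimal (Suc n) y \<and> (\<forall>i<Suc n. y i = x i)" if "minimal n x" for x n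
      using improve[of x "Suc n"] that by (auto simp: minimal_def)
  qed
  then obtain s where s: "\<And>n. minimal n (s n)" "\<And>n i. i < Suc n \<Longrightarrow> s (Suc n) i = s n i"
    by blast
  define g where "g n = s n n" for n
  have agree: "s n i = g i" if "i \<le> n" for n i
    using that by (induction n rule: dec_induct) (auto simp: g_def s(2))
  have g_bad: "\<not> list_emb P (g i) (g j)" if "i < j" for i j
  proof -
    have "\<not> list_emb P (s j i) (s j j)" using s(1)[of j] that by (simp add: minimal_def bad_def)
    then show ?thesis using that agree[of i j] agree[of j j] by simp
  qed
  have g_A: "g i \<in> lists A" for i using s(1)[of i] by (simp add: g_def minimal_def bad_def)
  \<comment> \<open>The empty list embeds into every list and so cannot occur in a bad
    sequence.\<close>
  have g_ne: "g i \<noteq> []" for i using g_bad[of i "Suc i"] by auto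
  have g_split: "g i = hd (g i) # tl (g i)" for i using g_ne by simp
  have hd_A: "hd (g i) \<in> A" for i using g_A[of i] g_ne[of i] by (simp add: in_lists_conv_set)
  obtain \<phi> :: "nat \<Rightarrow> nat" where \<phi>: "strict_mono \<phi>" "\<And>i j. i < j \<Longrightarrow> P (hd (g (\<phi> i))) (hd (g (\<phi> j)))"
    using wqo_on_monotone_subsequence[OF wqo, of "\<lambda>i. hd (g i)"] hd_A by blast
  \<comment> \<open>The competitor to \<open>g\<close>: from index \<open>\<phi> 0\<close> on, the
    terms are the tails along a subsequence with increasing heads. It is bad because an embedding
    between its terms lifts to one between terms of \<open>g\<close>, by extending the target list
    or by matching the comparable heads. Yet its term at \<open>\<phi> 0\<close> is shorter.\<close>
  define t where "t i = (if i < \<phi> 0 then g i else tl (g (\<phi> (i - \<phi> 0))))" for i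
  have tl_emb: "list_emb P xs (g i)" if "list_emb P xs (tl (g i))" for xs i
    using that by (subst g_split) (rule list_emb_Cons)
  have "bad t"
    unfolding bad_def
  proof (intro conjI allI impI)
    show "t i \<in> lists A" for i
      using g_A[of i] g_A[of "\<phi> (i - \<phi> 0)"] g_ne[of "\<phi> (i - \<phi> 0)"]
      by (auto simp: t_def in_lists_conv_set dest: list.set_sel(2))
    fix i j :: nat assume ij: "i < j"
    show "\<not> list_emb P (t i) (t j)"
    proof
      assume emb: "list_emb P (t i) (t j)"
      consider "j < \<phi> 0" | "i < \<phi> 0" "\<phi> 0 \<le> j" | "\<phi> 0 \<le> i" by linarith
      then show False
      proof cases
        case 1
        then show False using emb ij g_bad[OF ij] by (simp add: t_def)
      next
        case 2
        then have "list_emb P (g i) (g (\<phi> (j - \<phi> 0)))" using emb tl_emb by (simp add: t_def)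
        moreover have "\<phi> 0 \<le> \<phi> (j - \<phi> 0)" using \<phi>(1) by (simp add: strict_mono_less_eq)
        ultimately show False using 2 g_bad[of i "\<phi> (j - \<phi> 0)"] by auto
      next
        case 3
        let ?i = "i - \<phi> 0" and ?j = "j - \<phi> 0"
        have lt: "?i < ?j" using 3 ij by linarith
        have "list_emb P (hd (g (\<phi> ?i)) # tl (g (\<phi> ?i))) (hd (g (\<phi> ?j)) # tl (g (\<phi> ?j)))"
          using emb 3 ij \<phi>(2)[OF lt] by (intro list_emb_Cons2) (auto simp: t_def)
        then show False using g_bad[of "\<phi> ?i" "\<phi> ?j"] lt \<phi>(1) g_split by (simp add: strict_mono_less)
      qed
    qed
  qed
  moreover have "\<forall>i<\<phi> 0. t i = s (\<phi> 0) i" using agree by (simp add: t_def)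
  ultimately have "length (s (\<phi> 0) (\<phi> 0)) \<le> length (t (\<phi> 0))"
    using s(1)[of "\<phi> 0"] unfolding minimal_def by blast
  moreover have "length (tl (g (\<phi> 0))) < length (g (\<phi> 0))" using g_ne by simp
  ultimately show False by (simp add: t_def g_def[symmetric] del: length_tl)
qed

text \<open>A bad sequence of labelled graphs becomes an antichain once the index of each graph is added
  to its labels: this rules out that a later graph embeds into an earlier one.\<close>

lemma labelled_wqo_imp_wqo_on:
  fixes C :: "'a pair_pre_digraph set" and W :: "'w set"
  assumes C: "\<forall>G\<in>C. pair_graph G" and lw: "labelled_wqo TYPE('w \<times> nat) C" and W: "wqo_on W le"
  shows "wqo_on {(G, l). G \<in> C \<and> l ` pverts G \<subseteq> W} (labelled_induced_subgraph le)"
    (is "wqo_on ?S _")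
proof (rule wqo_onI)
  fix x assume "x \<in> ?S"
  then obtain G l where x: "x = (G, l)" "G \<in> C" "l ` pverts G \<subseteq> W" by auto
  show "labelled_induced_subgraph le x x"
    unfolding x(1) labelled_induced_subgraph_iff[OF bspec[OF C x(2)]]
    using x(3) wqo_on_refl[OF W] by (intro exI[of _ id]) auto
next
  fix x y z
  assume xyz: "x \<in> ?S" "y \<in> ?S" "z \<in> ?S" "labelled_induced_subgraph le x y"
    "labelled_induced_subgraph le y z"
  obtain G l H m K n where
    x: "x = (G, l)" "G \<in> C" "l ` pverts G \<subseteq> W" and
    y: "y = (H, m)" "H \<in> C" "m ` pverts H \<subseteq> W" and
    z: "z = (K, n)" "K \<in> C" "n ` pverts K \<subseteq> W" using xyz by auto
  note iff = labelled_induced_subgraph_iff[OF bspec[OF C]]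
  obtain f where f: "inj_on f (pverts G)" "f ` pverts G \<subseteq> pverts H"
    "\<forall>u\<in>pverts G. \<forall>v\<in>pverts G. (u, v) \<in> parcs G \<longleftrightarrow> (f u, f v) \<in> parcs H"
    "\<forall>v\<in>pverts G. le (l v) (m (f v))"
    using xyz(4) x y by (auto simp: iff)
  obtain g where g: "inj_on g (pverts H)" "g ` pverts H \<subseteq> pverts K"
    "\<forall>u\<in>pverts H. \<forall>v\<in>pverts H. (u, v) \<in> parcs H \<longleftrightarrow> (g u, g v) \<in> parcs K"
    "\<forall>v\<in>pverts H. le (m v) (n (g v))"
    using xyz(5) y z by (auto simp: iff)
  have fv: "f v \<in> pverts H" if "v \<in> pverts G" for v using f(2) that by blast
  have gv: "g v \<in> pverts K" if "v \<in> pverts H" for v using g(2) that by blast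
  have "inj_on (g \<circ> f) (pverts G)" using f g by (meson comp_inj_on inj_on_subset)
  moreover have "le (l v) (n (g (f v)))" if v: "v \<in> pverts G" for v
    using wqo_on_trans[OF W, of "l v" "m (f v)" "n (g (f v))"] v f(4) g(4) fv gv x(3) y(3) z(3)
    by (simp add: image_subset_iff)
  ultimately show "labelled_induced_subgraph le x z"
    unfolding x(1) z(1) iff[OF z(2)] using f(3) g(3) fv gv
    by (intro exI[of _ "g \<circ> f"]) auto
next
  fix f :: "nat \<Rightarrow> ('a, 'w) labelled_graph"
  assume f: "\<And>i. f i \<in> ?S" and bad: "\<And>i j. i < j \<Longrightarrow> \<not> labelled_induced_subgraph le (f i) (f j)"
  define G l where "G i = fst (f i)" and "l i = snd (f i)" for i
  have f_eq: "f i = (G i, l i)" for i by (simp add: G_def l_def)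
  have GC: "G i \<in> C" and lW: "l i ` pverts (G i) \<subseteq> W" for i using f[of i] by (auto simp: f_eq)
  note iff = labelled_induced_subgraph_iff[OF bspec[OF C GC]]
  define le' where "le' = (\<lambda>x y :: 'w \<times> nat. le (fst x) (fst y) \<and> snd x \<le> snd y)"
  have W': "wqo_on (W \<times> UNIV) le'"
    unfolding le'_def by (rule wqo_on_Times[OF W wqo_on_nat])
  define h where "h i = (G i, \<lambda>v. (l i v, i))" for i
  have "i = j" if "h i = h j" for i j
    using that by (auto simp: h_def fun_eq_iff)
  then have "infinite (range h)" by (meson finite_imageD infinite_UNIV_nat injI)
  moreover have "\<forall>(H, m)\<in>range h. H \<in> C \<and> m ` pverts H \<subseteq> W \<times> UNIV"
    using GC lW by (auto simp: h_def)
  moreover have "pairwise (\<lambda>p q. \<not> labelled_induced_subgraph le' p q) (range h)"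
    unfolding pairwise_def
  proof (intro ballI impI, elim imageE, hypsubst)
    fix i j assume "h i \<noteq> h j"
    then consider "i < j" | "j < i" by (metis linorder_neqE_nat)
    then show "\<not> labelled_induced_subgraph le' (h i) (h j)"
    proof cases
      case 1
      then show ?thesis using bad[OF 1] unfolding f_eq h_def iff le'_def by auto
    next
      case 2
      \<comment> \<open>The graph without vertices embeds into everything. So \<open>G i\<close> has
        a vertex, and its label carries the index \<open>i\<close>, which is not at most
        \<open>j\<close>.\<close>
      have "pverts (G i) \<noteq> {}"
        using bad[of i "Suc i"] unfolding f_eq iff by auto
      then show ?thesis using 2 unfolding h_def iff le'_def by fastforce
    qed
  qed
  ultimately show False
    using lw W' unfolding labelled_wqo_def by blast
qed

section \<open>Multipartite tournaments\<close>

text \<open>\<open>R\<close> is an orientation of the complete multipartite graph whose parts are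
  the fibres of \<open>p\<close>, with any number of parts. Since arcs join different parts, the
  last assumption forbids exactly the directed triangles that meet three parts.\<close>

locale rainbow_acyclic_tournament =
  fixes V :: "'a set" and p :: "'a \<Rightarrow> 'c" and R :: "('a \<times> 'a) set"
  assumes arcD: "(u, v) \<in> R \<Longrightarrow> u \<in> V \<and> v \<in> V \<and> p u \<noteq> p v"
    and total: "u \<in> V \<Longrightarrow> v \<in> V \<Longrightarrow> p u \<noteq> p v \<Longrightarrow> (u, v) \<in> R \<or> (v, u) \<in> R"
    and asym: "(u, v) \<in> R \<Longrightarrow> (v, u) \<notin> R"
    and no_rainbow_cycle: "(u, v) \<in> R \<Longrightarrow> (v, w) \<in> R \<Longrightarrow> p u \<noteq> p w \<Longrightarrow> (w, u) \<notin> R"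
begin

lemma subtournament:
  assumes "U \<subseteq> V"
  shows "rainbow_acyclic_tournament U p (R \<inter> U \<times> U)"
proof
  fix u v
  show "(u, v) \<in> R \<inter> U \<times> U \<Longrightarrow> u \<in> U \<and> v \<in> U \<and> p u \<noteq> p v" using arcD[of u v] by simp
  show "u \<in> U \<Longrightarrow> v \<in> U \<Longrightarrow> p u \<noteq> p v \<Longrightarrow> (u, v) \<in> R \<inter> U \<times> U \<or> (v, u) \<in> R \<inter> U \<times> U"
    using total[of u v] assms by auto
  show "(u, v) \<in> R \<inter> U \<times> U \<Longrightarrow> (v, u) \<notin> R \<inter> U \<times> U" using asym[of u v] by simp
  show "(w, u) \<notin> R \<inter> U \<times> U" if "(u, v) \<in> R \<inter> U \<times> U" "(v, w) \<in> R \<inter> U \<times> U" "p u \<noteq> p w" for w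
    using no_rainbow_cycle[of u v w] that by simp
qed

text \<open>Induction along the path: if \<open>x\<close> dominates \<open>v\<close> and
  \<open>v\<close> dominates \<open>w\<close>, then \<open>x\<close> and \<open>w\<close> lie in
  different parts and are joined by an arc, which cannot lead from \<open>w\<close> to
  \<open>x\<close> without closing a rainbow triangle.\<close>

lemma arc_propagate:
  assumes "(x, u) \<in> R" and "(u, v) \<in> (R \<inter> {(a, b). p a \<in> S \<and> p b \<in> S})\<^sup>*" and "p x \<notin> S"
  shows "(x, v) \<in> R"
  using assms(2,1)
proof (induction rule: rtrancl_induct)
  case (step v w)
  then have "(x, v) \<in> R" "(v, w) \<in> R" "p x \<noteq> p w" using assms(3) by auto
  then show ?case using no_rainbow_cycle total arcD by blast
qed

text \<open>A shortest path contains no three consecutive vertices from different parts: the middle one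
  could be skipped.\<close>

lemma path_in_two_parts:
  assumes "(x, y) \<in> R\<^sup>*"
  obtains q where "(x, y) \<in> (R \<inter> {(a, b). p a \<in> {p x, q} \<and> p b \<in> {p x, q}})\<^sup>*"
proof -
  have "\<exists>q. (x, y) \<in> (R \<inter> {(a, b). p a \<in> {p x, q} \<and> p b \<in> {p x, q}})\<^sup>*"
    using assms
  proof (induction rule: converse_rtrancl_induct)
    case (step x u)
    then obtain q where q: "(u, y) \<in> (R \<inter> {(a, b). p a \<in> {p u, q} \<and> p b \<in> {p u, q}})\<^sup>*" by blast
    show ?case
    \<comment> \<open>If \<open>x\<close> lies in part \<open>q\<close>, the arc to \<open>u\<close>
      prolongs the path within its two parts. Otherwise \<open>x\<close> lies outside both parts,
      and \<open>arc_propagate\<close> replaces the whole path by a single arc.\<close>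
    proof (cases "p x = q")
      case True
      then have "(x, u) \<in> R \<inter> {(a, b). p a \<in> {p u, q} \<and> p b \<in> {p u, q}}" using step.hyps by simp
      then have "(x, y) \<in> (R \<inter> {(a, b). p a \<in> {p u, q} \<and> p b \<in> {p u, q}})\<^sup>*"
        using q by (rule converse_rtrancl_into_rtrancl)
      moreover have "{p u, q} = {p x, p u}" using True by auto
      ultimately show ?thesis by auto
    next
      case False
      then have "p x \<notin> {p u, q}" using arcD[OF step.hyps(1)] by simp
      then have "(x, y) \<in> R" by (rule arc_propagate[OF step.hyps(1) q])
      then show ?thesis by (intro exI[of _ "p y"]) auto
    qed
  qed auto
  then show thesis using that by blast
qed

text \<open>The endpoints of an arc of a strongly connected tournament lie on a cycle within two parts,
  so every vertex of another part dominates both or is dominated by both.  Hence that vertex is a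
  source or a sink.\<close>

lemma strongly_connected_two_parts:
  assumes strong: "\<And>u v. u \<in> V \<Longrightarrow> v \<in> V \<Longrightarrow> (u, v) \<in> R\<^sup>*"
  obtains a b where "p ` V \<subseteq> {a, b}"
proof -
  have False
    if xyz: "x \<in> V" "y \<in> V" "z \<in> V" "p x \<noteq> p y" "p x \<noteq> p z" "p y \<noteq> p z" for x y z
  proof -
    have arc: "(z, u) \<in> R \<longleftrightarrow> (z, v) \<in> R" if a: "(v, u) \<in> R" and ne: "p u \<noteq> p z" "p v \<noteq> p z" for u v
    proof
      assume zv: "(z, v) \<in> R"
      have "(v, u) \<in> (R \<inter> {(a, b). p a \<in> {p v, p u} \<and> p b \<in> {p v, p u}})\<^sup>*" using a by auto
      then show "(z, u) \<in> R" by (rule arc_propagate[OF zv]) (use ne in auto)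
    next
      assume zu: "(z, u) \<in> R"
      \<comment> \<open>Strong connectivity leads back from \<open>u\<close> to \<open>v\<close>.
        The path found uses the part of \<open>u\<close> and one more part, which must be that of
        \<open>v\<close>; as \<open>z\<close> is outside both, \<open>arc_propagate\<close>
        applies.\<close>
      obtain q where q: "(u, v) \<in> (R \<inter> {(a, b). p a \<in> {p u, q} \<and> p b \<in> {p u, q}})\<^sup>*"
        using path_in_two_parts strong arcD[OF a] by metis
      have "p v \<in> {p u, q}" using q by (cases rule: rtranclE) auto
      then have "q = p v" using arcD[OF a] by auto
      then show "(z, v) \<in> R" using arc_propagate[OF zu q] ne by auto
    qed
    have pair: "(z, u) \<in> R \<longleftrightarrow> (z, v) \<in> R"
      if "u \<in> V" "v \<in> V" "p u \<noteq> p v" "p u \<noteq> p z" "p v \<noteq> p z" for u v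
      using total[OF that(1-3)] arc that by blast
    \<comment> \<open>A vertex in the part of \<open>x\<close> is compared with \<open>x\<close> by
      way of \<open>y\<close>.\<close>
    have all: "(z, u) \<in> R \<longleftrightarrow> (z, x) \<in> R" if "u \<in> V" "p u \<noteq> p z" for u
      using pair[of u x] pair[of u y] pair[of x y] that xyz by metis
    show False
    proof (cases "(z, x) \<in> R")
      case True
      obtain w where "(w, z) \<in> R" using strong[OF xyz(1,3)] xyz by (cases rule: rtranclE) auto
      then show False using all[of w] arcD asym True by metis
    next
      case False
      obtain w where "(z, w) \<in> R" using strong[OF xyz(3,1)] xyz by (cases rule: converse_rtranclE) auto
      then show False using all[of w] arcD False by metis
    qed
  qed
  note no3 = this
  show thesis
  proof (cases "\<exists>x\<in>V. \<exists>y\<in>V. p x \<noteq> p y")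
    case True
    then obtain x y where xy: "x \<in> V" "y \<in> V" "p x \<noteq> p y" by blast
    have "p v \<in> {p x, p y}" if v: "v \<in> V" for v
    proof (rule ccontr)
      assume "p v \<notin> {p x, p y}"
      then have "p x \<noteq> p v" "p y \<noteq> p v" by auto
      then show False using no3 xy v by blast
    qed
    then have "p ` V \<subseteq> {p x, p y}" by blast
    then show thesis by (rule that)
  next
    case False
    \<comment> \<open>Here \<open>V\<close> is empty or lies in one part; \<open>undefined\<close>
      only fills the second place.\<close>
    then have "p ` V \<subseteq> {p (SOME v. v \<in> V), undefined}" by (metis image_subsetI insertI1 someI_ex)
    then show thesis by (rule that)
  qed
qed

text \<open>Split along reachability. If some vertex is not reachable from \<open>x\<close>, the set
  \<open>B\<close> of reachable vertices has no outgoing arcs, so all arcs between \<open>B\<close>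
  and its complement enter \<open>B\<close>, and the slices of the complement are listed before
  those of \<open>B\<close>. If there is no such \<open>x\<close>, the tournament is strongly
  connected and forms one slice.\<close>

lemma slices:
  assumes "finite V"
  shows "\<exists>Ss. (\<Union>(set Ss) = V \<and> (\<forall>S\<in>set Ss. S \<noteq> {} \<and> (\<exists>a b. p ` S \<subseteq> {a, b}))) \<and>
    sorted_wrt (\<lambda>S T. S \<inter> T = {} \<and> (\<forall>u\<in>S. \<forall>v\<in>T. p u \<noteq> p v \<longrightarrow> (u, v) \<in> R)) Ss"
    (is "\<exists>Ss. ?slices V Ss \<and> sorted_wrt ?before Ss")
proof -
  have "\<exists>Ss. ?slices U Ss \<and> sorted_wrt ?before Ss" if "finite U" "U \<subseteq> V" for U
    using that
  proof (induction U rule: finite_psubset_induct)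
    case (psubset U)
    let ?R = "R \<inter> U \<times> U"
    interpret U: rainbow_acyclic_tournament U p ?R using psubset.prems by (rule subtournament)
    consider "U = {}" | "U \<noteq> {}" "\<forall>u\<in>U. \<forall>v\<in>U. (u, v) \<in> ?R\<^sup>*" |
      x y where "x \<in> U" "y \<in> U" "(x, y) \<notin> ?R\<^sup>*" by blast
    then show ?case
    proof cases
      case 1
      then show ?thesis by (intro exI[of _ "[]"]) simp
    next
      case 2
      then obtain a b where "p ` U \<subseteq> {a, b}" using U.strongly_connected_two_parts by blast
      then show ?thesis using 2 by (intro exI[of _ "[U]"]) auto
    next
      case 3
      define B where "B = {v\<in>U. (x, v) \<in> ?R\<^sup>*}"
      have closed: "v \<in> B" if "u \<in> B" "(u, v) \<in> ?R" for u v
        using that unfolding B_def by (auto intro: rtrancl_into_rtrancl)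
      have B: "B \<subset> U" "U - B \<subset> U" using 3 by (auto simp: B_def)
      have "B \<subseteq> V" "U - B \<subseteq> V" using B psubset.prems by auto
      obtain Ts where Ts: "?slices B Ts" "sorted_wrt ?before Ts"
        using psubset.IH[OF B(1) \<open>B \<subseteq> V\<close>] by (elim exE conjE) (rule that; simp)
      obtain Ss where Ss: "?slices (U - B) Ss" "sorted_wrt ?before Ss"
        using psubset.IH[OF B(2) \<open>U - B \<subseteq> V\<close>] by (elim exE conjE) (rule that; simp)
      have "?before S T" if "S \<in> set Ss" "T \<in> set Ts" for S T
      proof -
        have S: "S \<subseteq> U - B" and T: "T \<subseteq> B" using that Ss(1) Ts(1) by blast+
        have "(u, v) \<in> R" if "u \<in> S" "v \<in> T" "p u \<noteq> p v" for u v
        proof -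
          have "u \<in> U" "v \<in> U" "u \<notin> B" "v \<in> B" using that S T B by auto
          then show ?thesis using U.total[of u v] closed[of v u] that by blast
        qed
        then show ?thesis using S T by blast
      qed
      then have "sorted_wrt ?before (Ss @ Ts)" using Ss(2) Ts(2) by (auto simp: sorted_wrt_append)
      moreover have "?slices U (Ss @ Ts)" using Ss(1) Ts(1) B by auto
      ultimately show ?thesis by blast
    qed
  qed
  then show ?thesis using assms by blast
qed

end

section \<open>Slicing curious graphs\<close>

definition induced_on :: "'a pair_pre_digraph \<Rightarrow> 'a set \<Rightarrow> 'a pair_pre_digraph" where
  "induced_on G S = \<lparr>pverts = S, parcs = parcs G \<inter> S \<times> S\<rparr>"

lemma induced_on_simps [simp]:
  "pverts (induced_on G S) = S" "parcs (induced_on G S) = parcs G \<inter> S \<times> S"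
  by (simp_all add: induced_on_def)

lemma pair_graph_arc_sym:
  assumes "pair_graph G"
  shows "(u, v) \<in> parcs G \<longleftrightarrow> (v, u) \<in> parcs G"
proof -
  interpret pair_graph G by fact
  show ?thesis using arcs_symmetric by blast
qed

lemma pair_graph_arc_verts: "pair_graph G \<Longrightarrow> (u, v) \<in> parcs G \<Longrightarrow> u \<in> pverts G \<and> v \<in> pverts G"
  by (metis pair_graph_def pair_digraph_def pair_fin_digraph_def pair_wf_digraph.in_arcsD1
      pair_wf_digraph.in_arcsD2)

lemma pair_graph_finite: "pair_graph G \<Longrightarrow> finite (pverts G)"
  by (auto simp: pair_graph_def pair_digraph_def intro: pair_fin_digraph.pair_finite_verts)

lemma induced_on_pverts: "pair_graph G \<Longrightarrow> induced_on G (pverts G) = G"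
  by (auto simp: induced_on_def intro!: pair_pre_digraph.equality dest: pair_graph_arc_verts)

lemma pair_graph_induced_on:
  assumes "pair_graph G" "S \<subseteq> pverts G"
  shows "pair_graph (induced_on G S)"
proof -
  interpret pair_graph G by fact
  show ?thesis
    by unfold_locales
      (use assms(2) no_loops' arcs_symmetric in
        \<open>auto simp: symmetric_def intro: symI finite_subset[OF assms(2)] finite_subset[OF _ pair_finite_arcs]\<close>)
qed

lemma hereditary_induced_on:
  assumes "graph_class X" "hereditary X" "G \<in> X" "S \<subseteq> pverts G"
  shows "induced_on G S \<in> X"
proof -
  have "pair_graph G" using assms by (simp add: graph_class_def)
  then have "induced_subgraph (with_proj (induced_on G S)) (with_proj G)"
    using assms(4) by (simp add: induced_subgraph_with_proj)
  then show ?thesis using assms unfolding hereditary_def by blast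
qed

text \<open>In terms of adjacency, all arcs of the associated tournament between \<open>S\<close>
  and \<open>T\<close> lead from \<open>S\<close> to \<open>T\<close>. For \<open>p\<close> with
  values below 3 the condition also makes vertices of the same part non-adjacent, because
  \<open>p v\<close> differs from \<open>(p v + 1) mod 3\<close>.\<close>

definition slice_before :: "'a pair_pre_digraph \<Rightarrow> ('a \<Rightarrow> nat) \<Rightarrow> 'a set \<Rightarrow> 'a set \<Rightarrow> bool" where
  "slice_before G p S T \<longleftrightarrow> S \<inter> T = {} \<and>
     (\<forall>u\<in>S. \<forall>v\<in>T. (u, v) \<in> parcs G \<longleftrightarrow> p u = (p v + 1) mod 3)"

text \<open>The slices are those of the tournament associated with a curious partition. A slice
  meets at most two of the independent parts, so it induces a bipartite graph.\<close>

lemma curious_slicing: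
  assumes G: "pair_graph G" and "curious G"
  shows "\<exists>p Ss. (\<forall>v. p v < 3) \<and> \<Union>(set Ss) = pverts G \<and>
    (\<forall>S\<in>set Ss. S \<noteq> {} \<and> bipartite (induced_on G S)) \<and> sorted_wrt (slice_before G p) Ss"
proof -
  obtain V1 V2 V3 where ind: "independent_set G V1" "independent_set G V2" "independent_set G V3"
    and disj: "V1 \<inter> V2 = {}" "V1 \<inter> V3 = {}" "V2 \<inter> V3 = {}" and un: "V1 \<union> V2 \<union> V3 = pverts G"
    and rainbow: "\<not> (\<exists>x\<in>V1. \<exists>y\<in>V2. \<exists>z\<in>V3.
          ((x, y) \<in> parcs G \<and> (y, z) \<in> parcs G \<and> (x, z) \<in> parcs G) \<or>
          ((x, y) \<notin> parcs G \<and> (y, z) \<notin> parcs G \<and> (x, z) \<notin> parcs G))"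
    using \<open>curious G\<close> unfolding curious_def by blast
  define p :: "'a \<Rightarrow> nat" where "p v = (if v \<in> V1 then 0 else if v \<in> V2 then 1 else 2)" for v
  have p3: "p v < 3" for v by (simp add: p_def)
  then have p_cases: "p v = 0 \<or> p v = 1 \<or> p v = 2" for v
    by (metis One_nat_def less_2_cases less_Suc_eq numeral_2_eq_2 numeral_3_eq_3)
  have p_part: "p v = 0 \<Longrightarrow> v \<in> V1" "p v = 1 \<Longrightarrow> v \<in> V2" "p v = 2 \<Longrightarrow> v \<in> V3" if "v \<in> pverts G" for v
    using that un by (auto simp: p_def split: if_splits)
  have p_ne: "p u \<noteq> p v" if "(u, v) \<in> parcs G" for u v
    using that ind p_part[of u] p_part[of v] p_cases[of u] pair_graph_arc_verts[OF G that]
    unfolding independent_set_def by metis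
  note sym = pair_graph_arc_sym[OF G]
  have rb: "\<not> ((y, x) \<in> parcs G \<and> (z, y) \<in> parcs G \<and> (x, z) \<in> parcs G)"
    "\<not> ((x, y) \<notin> parcs G \<and> (y, z) \<notin> parcs G \<and> (z, x) \<notin> parcs G)"
    if "x \<in> pverts G" "y \<in> pverts G" "z \<in> pverts G" "p x = 0" "p y = 1" "p z = 2" for x y z
    using rainbow p_part(1)[OF that(1,4)] p_part(2)[OF that(2,5)] p_part(3)[OF that(3,6)] sym
    by meson+
  \<comment> \<open>Of two different parts exactly one is the cyclic successor of the other, while
    adjacency is symmetric; hence exactly one of the two orientations obeys the rule defining
    \<open>R\<close>.\<close>
  have flip: "((u, v) \<in> parcs G \<longleftrightarrow> p u = (p v + 1) mod 3) \<longleftrightarrow>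
    \<not> ((v, u) \<in> parcs G \<longleftrightarrow> p v = (p u + 1) mod 3)" if "p u \<noteq> p v" for u v
  proof -
    have "p u = (p v + 1) mod 3 \<longleftrightarrow> p v \<noteq> (p u + 1) mod 3"
      using p_cases[of u] p_cases[of v] that by (elim disjE) simp_all
    then show ?thesis using sym[of u v] by blast
  qed
  define R where "R = {(u, v). u \<in> pverts G \<and> v \<in> pverts G \<and> p u \<noteq> p v \<and>
    ((u, v) \<in> parcs G \<longleftrightarrow> p u = (p v + 1) mod 3)}"
  interpret rainbow_acyclic_tournament "pverts G" p R
  proof
    show "(u, v) \<in> R \<Longrightarrow> u \<in> pverts G \<and> v \<in> pverts G \<and> p u \<noteq> p v" for u v
      by (simp add: R_def)
    show "u \<in> pverts G \<Longrightarrow> v \<in> pverts G \<Longrightarrow> p u \<noteq> p v \<Longrightarrow> (u, v) \<in> R \<or> (v, u) \<in> R" for u v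
      unfolding R_def mem_Collect_eq case_prod_conv using flip[of u v] by metis
    show "(u, v) \<in> R \<Longrightarrow> (v, u) \<notin> R" for u v
      unfolding R_def mem_Collect_eq case_prod_conv using flip[of u v] by metis
    show "(w, u) \<notin> R" if uvw: "(u, v) \<in> R" "(v, w) \<in> R" "p u \<noteq> p w" for u v w
    proof
      assume wu: "(w, u) \<in> R"
      have V: "u \<in> pverts G" "v \<in> pverts G" "w \<in> pverts G" using uvw by (auto simp: R_def)
      have ne: "p u \<noteq> p v" "p v \<noteq> p w" using uvw by (auto simp: R_def)
      have a: "(u, v) \<in> parcs G \<longleftrightarrow> p u = (p v + 1) mod 3" "(v, w) \<in> parcs G \<longleftrightarrow> p v = (p w + 1) mod 3"
        "(w, u) \<in> parcs G \<longleftrightarrow> p w = (p u + 1) mod 3" using uvw wu by (auto simp: R_def)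
      \<comment> \<open>A directed triangle running in the cyclic order of the parts consists of
        three non-adjacent pairs, a rainbow \<open>3P1\<close>; one running against it consists of
        three edges, a rainbow \<open>K3\<close>.\<close>
      consider "p u = 0" "p v = 1" "p w = 2" | "p u = 1" "p v = 2" "p w = 0"
        | "p u = 2" "p v = 0" "p w = 1" | "p u = 0" "p v = 2" "p w = 1"
        | "p u = 1" "p v = 0" "p w = 2" | "p u = 2" "p v = 1" "p w = 0"
        using p_cases[of u] p_cases[of v] p_cases[of w] ne uvw(3) by metis
      then show False
        using a rb[of u v w] rb[of v w u] rb[of w u v] rb[of u w v] rb[of w v u] rb[of v u w] V
        by cases simp_all
    qed
  qed
  obtain Ss where Ss: "\<Union>(set Ss) = pverts G" "\<forall>S\<in>set Ss. S \<noteq> {} \<and> (\<exists>a b. p ` S \<subseteq> {a, b})"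
    "sorted_wrt (\<lambda>S T. S \<inter> T = {} \<and> (\<forall>u\<in>S. \<forall>v\<in>T. p u \<noteq> p v \<longrightarrow> (u, v) \<in> R)) Ss"
    using slices pair_graph_finite[OF G] by blast
  have "bipartite (induced_on G S)" if S: "S \<in> set Ss" for S
  proof -
    obtain a b where ab: "p ` S \<subseteq> {a, b}" using Ss(2) S by blast
    show ?thesis
      unfolding bipartite_def independent_set_def
    proof (intro exI conjI)
      \<comment> \<open>The second side lies entirely in part \<open>b\<close>.\<close>
      show "{v\<in>S. p v = a} \<union> {v\<in>S. p v \<noteq> a} = pverts (induced_on G S)" by auto
    qed (use ab p_ne in \<open>auto simp: image_subset_iff\<close>, metis p_ne)
  qed
  moreover have "sorted_wrt (slice_before G p) Ss"
  proof (rule sorted_wrt_mono_rel[OF _ Ss(3)])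
    fix S T
    assume ST: "S \<in> set Ss" "T \<in> set Ss"
      "S \<inter> T = {} \<and> (\<forall>u\<in>S. \<forall>v\<in>T. p u \<noteq> p v \<longrightarrow> (u, v) \<in> R)"
    have "(u, v) \<in> parcs G \<longleftrightarrow> p u = (p v + 1) mod 3" if "u \<in> S" "v \<in> T" for u v
    proof (cases "p u = p v")
      case True
      then show ?thesis using p_ne[of u v] p_cases[of v] by auto
    next
      case False
      then have "(u, v) \<in> R" using ST(3) that by blast
      then show ?thesis by (simp add: R_def)
    qed
    then show "slice_before G p S T" using ST(3) by (simp add: slice_before_def)
  qed
  ultimately show ?thesis using p3 Ss by blast
qed

section \<open>Gluing embeddings of slices\<close>

text \<open>The second label component forces the embeddings of the slices to preserve parts, and
  \<open>list_emb\<close> preserves the order of the slices. Adjacency between different slices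
  depends only on these data, so the embeddings glue together.\<close>

lemma list_emb_slices_imp_embedding:
  assumes G: "pair_graph G" and H: "pair_graph H"
    and emb: "list_emb (labelled_induced_subgraph (\<lambda>x y. le (fst x) (fst y) \<and> snd x = snd y))
      (map (\<lambda>S. (induced_on G S, \<lambda>v. (l v, p v))) Ss) (map (\<lambda>T. (induced_on H T, \<lambda>v. (m v, q v))) Ts)"
    and "sorted_wrt (slice_before G p) Ss" "sorted_wrt (slice_before H q) Ts"
    and "\<Union>(set Ss) \<subseteq> pverts G" "\<Union>(set Ts) \<subseteq> pverts H"
  shows "\<exists>f. inj_on f (\<Union>(set Ss)) \<and> f ` \<Union>(set Ss) \<subseteq> \<Union>(set Ts) \<and>
    (\<forall>u\<in>\<Union>(set Ss). \<forall>v\<in>\<Union>(set Ss). (u, v) \<in> parcs G \<longleftrightarrow> (f u, f v) \<in> parcs H) \<and>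
    (\<forall>v\<in>\<Union>(set Ss). le (l v) (m (f v)) \<and> p v = q (f v))"
  using emb assms(4-)
\<comment> \<open>The induction follows the rules of \<open>list_emb\<close>: a skipped target slice
  leaves the map as it is, and a matched pair of slices enlarges it by the embedding between
  them.\<close>
proof (induction "map (\<lambda>S. (induced_on G S, \<lambda>v. (l v, p v))) Ss"
    "map (\<lambda>T. (induced_on H T, \<lambda>v. (m v, q v))) Ts" arbitrary: Ss Ts rule: list_emb.induct)
  case (list_emb_Nil Ts Ss)
  then show ?case by simp
next
  case (list_emb_Cons ys y Ss Ts)
  then obtain T Us where [simp]: "Ts = T # Us" and ys: "ys = map (\<lambda>T. (induced_on H T, \<lambda>v. (m v, q v))) Us"
    by (auto simp: Cons_eq_map_conv)
  have "\<exists>f. inj_on f (\<Union>(set Ss)) \<and> f ` \<Union>(set Ss) \<subseteq> \<Union>(set Us) \<and>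
    (\<forall>u\<in>\<Union>(set Ss). \<forall>v\<in>\<Union>(set Ss). (u, v) \<in> parcs G \<longleftrightarrow> (f u, f v) \<in> parcs H) \<and>
    (\<forall>v\<in>\<Union>(set Ss). le (l v) (m (f v)) \<and> p v = q (f v))"
    by (rule list_emb_Cons.hyps(2)[OF refl ys]) (use list_emb_Cons.prems in auto)
  then show ?case by fastforce
next
  case (list_emb_Cons2 x y xs ys Ss Ts)
  from list_emb_Cons2.hyps(4) obtain S Rs where Ss [simp]: "Ss = S # Rs"
    and x: "x = (induced_on G S, \<lambda>v. (l v, p v))" and xs: "xs = map (\<lambda>S. (induced_on G S, \<lambda>v. (l v, p v))) Rs"
    by (auto simp: Cons_eq_map_conv)
  from list_emb_Cons2.hyps(5) obtain T Us where Ts [simp]: "Ts = T # Us"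
    and y: "y = (induced_on H T, \<lambda>v. (m v, q v))" and ys: "ys = map (\<lambda>T. (induced_on H T, \<lambda>v. (m v, q v))) Us"
    by (auto simp: Cons_eq_map_conv)
  let ?A = "\<Union>(set Rs)" and ?B = "\<Union>(set Us)"
  have "\<exists>g. inj_on g ?A \<and> g ` ?A \<subseteq> ?B \<and>
    (\<forall>u\<in>?A. \<forall>v\<in>?A. (u, v) \<in> parcs G \<longleftrightarrow> (g u, g v) \<in> parcs H) \<and>
    (\<forall>v\<in>?A. le (l v) (m (g v)) \<and> p v = q (g v))"
    by (rule list_emb_Cons2.hyps(3)[OF xs ys]) (use list_emb_Cons2.prems in auto)
  then obtain g where "inj_on g ?A" "g ` ?A \<subseteq> ?B"
    "\<forall>u\<in>?A. \<forall>v\<in>?A. (u, v) \<in> parcs G \<longleftrightarrow> (g u, g v) \<in> parcs H"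
    "\<forall>v\<in>?A. le (l v) (m (g v)) \<and> p v = q (g v)"
    by (elim exE conjE) (rule that)
  note g = this(1) subsetD[OF this(2) imageI] this(3)[rule_format] this(4)[rule_format]
  have SV: "S \<subseteq> pverts G" "T \<subseteq> pverts H" using list_emb_Cons2.prems by auto
  obtain f where f: "inj_on f S" "\<And>v. v \<in> S \<Longrightarrow> f v \<in> T"
    "\<And>u v. u \<in> S \<Longrightarrow> v \<in> S \<Longrightarrow> (u, v) \<in> parcs G \<longleftrightarrow> (f u, f v) \<in> parcs H"
    "\<And>v. v \<in> S \<Longrightarrow> le (l v) (m (f v)) \<and> p v = q (f v)"
    using list_emb_Cons2.hyps(1)
    unfolding x y labelled_induced_subgraph_iff[OF pair_graph_induced_on[OF H SV(2)]]
    by (auto simp: image_subset_iff)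
  define h where "h v = (if v \<in> S then f v else g v)" for v
  have before: "slice_before G p S ?A" "slice_before H q T ?B"
    using list_emb_Cons2.prems by (auto simp: slice_before_def)
  have disj: "S \<inter> ?A = {}" "T \<inter> ?B = {}" using before by (auto simp: slice_before_def)
  have hS: "h v = f v" if "v \<in> S" for v using that by (simp add: h_def)
  have hA: "h v = g v" if "v \<in> ?A" for v using that disj by (auto simp: h_def)
  \<comment> \<open>Both adjacencies are decided by the parts, which \<open>f\<close> and
    \<open>g\<close> preserve.\<close>
  have cross: "(u, v) \<in> parcs G \<longleftrightarrow> (h u, h v) \<in> parcs H" if "u \<in> S" "v \<in> ?A" for u v
    using before that f(2,4)[of u] g(2,4)[of v] unfolding slice_before_def hS[OF that(1)] hA[OF that(2)]
    by metis
  have "h ` S \<subseteq> T" using hS f(2) by auto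
  moreover have "h ` ?A \<subseteq> ?B" using hA g(2) by (metis image_subsetI)
  moreover have "inj_on h S" using f(1) hS by (simp cong: inj_on_cong)
  moreover have "inj_on h ?A" using g(1) inj_on_cong[of ?A h g] hA by blast
  ultimately have "inj_on h (S \<union> ?A)" "h ` (S \<union> ?A) \<subseteq> T \<union> ?B"
    using disj(2) unfolding inj_on_Un by blast+
  moreover have "(u, v) \<in> parcs G \<longleftrightarrow> (h u, h v) \<in> parcs H" if uv: "u \<in> S \<union> ?A" "v \<in> S \<union> ?A" for u v
  proof -
    consider "u \<in> S" "v \<in> S" | "u \<in> S" "v \<in> ?A" | "u \<in> ?A" "v \<in> S" | "u \<in> ?A" "v \<in> ?A"
      using uv by blast
    then show ?thesis
    proof cases
      case 1
      then show ?thesis unfolding hS[OF 1(1)] hS[OF 1(2)] by (rule f(3))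
    next
      case 2
      then show ?thesis by (rule cross)
    next
      case 3
      show ?thesis
        using cross[OF 3(2,1)] pair_graph_arc_sym[OF G, of u v] pair_graph_arc_sym[OF H, of "h u" "h v"]
        by blast
    next
      case 4
      then show ?thesis unfolding hA[OF 4(1)] hA[OF 4(2)] by (rule g(3))
    qed
  qed
  moreover have "le (l v) (m (h v)) \<and> p v = q (h v)" if "v \<in> S \<union> ?A" for v
    using that f(4)[of v] g(4)[of v] hS[of v] hA[of v] by (cases "v \<in> S") auto
  ultimately show ?case unfolding Ss Ts list.set Union_insert by blast
qed

section \<open>Transfer of the well-quasi-order from bipartite to curious graphs\<close>

lemma labelled_wqo_curious:
  fixes X :: "'a pair_pre_digraph set"
  assumes X: "graph_class X" "hereditary X" and bip: "labelled_wqo TYPE(nat) {G \<in> X. bipartite G}"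
  shows "labelled_wqo TYPE('w) {G \<in> X. curious G}"
  unfolding labelled_wqo_def
proof (intro allI impI notI)
  fix W :: "'w set" and le
  assume W: "wqo_on W le"
  assume "\<exists>A :: ('a, 'w) labelled_graph set. infinite A \<and>
    (\<forall>(G, l)\<in>A. G \<in> {G \<in> X. curious G} \<and> l ` pverts G \<subseteq> W) \<and>
    pairwise (\<lambda>p q. \<not> labelled_induced_subgraph le p q) A"
  then obtain A :: "('a, 'w) labelled_graph set" where A: "infinite A"
    "\<forall>(G, l)\<in>A. G \<in> {G \<in> X. curious G} \<and> l ` pverts G \<subseteq> W"
    "pairwise (\<lambda>p q. \<not> labelled_induced_subgraph le p q) A" by blast
  obtain s :: "nat \<Rightarrow> ('a, 'w) labelled_graph" where s: "inj s" "range s \<subseteq> A"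
    using A(1) by (meson infinite_countable_subset)
  define G l where "G i = fst (s i)" and "l i = snd (s i)" for i
  have s_eq: "s i = (G i, l i)" for i by (simp add: G_def l_def)
  have GX: "G i \<in> X" and cur: "curious (G i)" and lW: "l i ` pverts (G i) \<subseteq> W" for i
    using bspec[OF A(2), of "s i"] s(2) by (auto simp: s_eq)
  have pg: "pair_graph H" if "H \<in> X" for H using X(1) that by (simp add: graph_class_def)
  obtain p Ss where p3: "\<And>i v. p i v < 3" and un: "\<And>i. \<Union>(set (Ss i)) = pverts (G i)"
    and bi: "\<And>i S. S \<in> set (Ss i) \<Longrightarrow> bipartite (induced_on (G i) S)"
    and ord: "\<And>i. sorted_wrt (slice_before (G i) (p i)) (Ss i)"
    using curious_slicing[OF pg[OF GX] cur] by metis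
  let ?le = "\<lambda>x y :: 'w \<times> nat. le (fst x) (fst y) \<and> snd x = snd y"
  let ?S = "{(H, m). H \<in> {G \<in> X. bipartite G} \<and> m ` pverts H \<subseteq> W \<times> {..<3::nat}}"
  \<comment> \<open>Each label is paired with the number of the part, compared by equality; this is
    a well-quasi-order as there are three parts. \<open>labelled_wqo_nat_imp\<close> lifts the
    hypothesis from \<open>nat\<close> to these pairs, extended by the index that
    \<open>labelled_wqo_imp_wqo_on\<close> asks for.\<close>
  have "wqo_on ?S (labelled_induced_subgraph ?le)"
    using pg by (intro labelled_wqo_imp_wqo_on labelled_wqo_nat_imp[OF _ bip] wqo_on_Times[OF W]
        wqo_on_finite_eq) auto
  then have wqo: "wqo_on (lists ?S) (list_emb (labelled_induced_subgraph ?le))"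
    by (rule wqo_on_list_emb)
  define L where "L i = map (\<lambda>S. (induced_on (G i) S, \<lambda>v. (l i v, p i v))) (Ss i)" for i
  have "L i \<in> lists ?S" for i
  proof -
    have "induced_on (G i) S \<in> X" if "S \<in> set (Ss i)" for S
      using hereditary_induced_on[OF X GX, of S i] un[of i] that by blast
    moreover have "l i v \<in> W" if "v \<in> S" "S \<in> set (Ss i)" for v S
      using lW[of i] un[of i] that by blast
    ultimately show ?thesis using bi p3 by (auto simp: L_def in_lists_conv_set)
  qed
  then obtain i j where ij: "i < j" "list_emb (labelled_induced_subgraph ?le) (L i) (L j)"
    using wqo_onE[OF wqo, of L] by blast
  have "labelled_induced_subgraph le (s i) (s j)"
    using list_emb_slices_imp_embedding[OF pg[OF GX] pg[OF GX] ij(2)[unfolded L_def] ord ord]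
    unfolding s_eq labelled_induced_subgraph_iff[OF pg[OF GX]] un by blast
  moreover have "s i \<noteq> s j" using s(1) ij(1) by (metis injD nat_neq_iff)
  ultimately show False using A(3) s(2) unfolding pairwise_def by blast
qed

section \<open>Clique-width\<close>

lemma cw_construct_mono: "cw_construct k G l \<Longrightarrow> k \<le> K \<Longrightarrow> cw_construct K G l"
  by (induction rule: cw_construct.induct) (auto intro: cw_construct.intros)

lemma cw_construct_label_less: "cw_construct k G l \<Longrightarrow> v \<in> pverts G \<Longrightarrow> l v < k"
  by (induction rule: cw_construct.induct) (auto split: if_splits)

text \<open>Joins leave the labels alone, so the joins for the pairs in \<open>J\<close> can be made
  one after another.\<close>

lemma cw_construct_joins:
  assumes "finite J" "cw_construct k G l" "\<And>i j. (i, j) \<in> J \<Longrightarrow> i < k \<and> j < k \<and> i \<noteq> j"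
  shows "cw_construct k \<lparr>pverts = pverts G, parcs = parcs G \<union>
    {(u, v). u \<in> pverts G \<and> v \<in> pverts G \<and> ((l u, l v) \<in> J \<or> (l v, l u) \<in> J)}\<rparr> l"
  using assms(1,3)
proof (induction J)
  case empty
  then show ?case using assms(2) by (cases G) simp
next
  case (insert e J)
  obtain i j where e: "e = (i, j)" by (cases e)
  have "i < k" "j < k" "i \<noteq> j" using insert.prems[of i j] e by auto
  have J: "\<And>i j. (i, j) \<in> J \<Longrightarrow> i < k \<and> j < k \<and> i \<noteq> j" using insert.prems by blast
  from join[OF insert.IH[OF J] \<open>i < k\<close> \<open>j < k\<close> \<open>i \<noteq> j\<close>]
  have "cw_construct k \<lparr>pverts = pverts G, parcs = parcs G \<union>
    {(u, v). u \<in> pverts G \<and> v \<in> pverts G \<and> ((l u, l v) \<in> J \<or> (l v, l u) \<in> J)} \<union>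
    {(u, v). u \<in> pverts G \<and> v \<in> pverts G \<and> (l u = i \<and> l v = j \<or> l u = j \<and> l v = i)}\<rparr> l"
    by simp
  also have "parcs G \<union>
    {(u, v). u \<in> pverts G \<and> v \<in> pverts G \<and> ((l u, l v) \<in> J \<or> (l v, l u) \<in> J)} \<union>
    {(u, v). u \<in> pverts G \<and> v \<in> pverts G \<and> (l u = i \<and> l v = j \<or> l u = j \<and> l v = i)} =
    parcs G \<union> {(u, v). u \<in> pverts G \<and> v \<in> pverts G \<and>
      ((l u, l v) \<in> insert e J \<or> (l v, l u) \<in> insert e J)}"
    by (auto simp: e)
  finally show ?case .
qed

text \<open>As \<open>f\<close> maps \<open>I\<close> outside \<open>I\<close>, a label that was
  changed is never changed again, and relabelling one element of \<open>I\<close> at a time amounts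
  to relabelling all at once.\<close>

lemma cw_construct_relabels:
  assumes "finite I" "cw_construct k G l" "\<And>i. i \<in> I \<Longrightarrow> i < k \<and> f i < k \<and> f i \<notin> I"
  shows "cw_construct k G (\<lambda>v. if l v \<in> I then f (l v) else l v)"
  using assms(1,3)
proof (induction I)
  case empty
  then show ?case using assms(2) by simp
next
  case (insert i I)
  have "cw_construct k G (\<lambda>v. if (if l v \<in> I then f (l v) else l v) = i then f i
      else if l v \<in> I then f (l v) else l v)"
    using insert by (intro relabel) auto
  also have "(\<lambda>v. if (if l v \<in> I then f (l v) else l v) = i then f i
      else if l v \<in> I then f (l v) else l v) = (\<lambda>v. if l v \<in> insert i I then f (l v) else l v)"
    using insert.hyps insert.prems by (auto simp: fun_eq_iff)
  finally show ?case .
qed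

text \<open>The same construction is carried out with labels that also remember the part:
  \<open>3 * l v + p v\<close> encodes the old label and the part of \<open>v\<close>. A join turns
  into nine joins and a relabelling between different labels into three relabellings.\<close>

lemma cw_construct_refine:
  fixes p :: "'a \<Rightarrow> nat"
  assumes "cw_construct k G l" "3 * k \<le> K" "\<And>v. p v < 3"
  shows "\<exists>l'. cw_construct K G l' \<and> (\<forall>v\<in>pverts G. l' v = 3 * l v + p v)"
  using assms(1)
proof induction
  case (new_vertex i v)
  have "3 * i + p v < K" using new_vertex assms(2) assms(3)[of v] by linarith
  from cw_construct.new_vertex[OF this, of v] show ?case by auto
next
  case (disjoint_union G l H m)
  then obtain l' m' where
    l': "cw_construct K G l'" "\<forall>v\<in>pverts G. l' v = 3 * l v + p v" and
    m': "cw_construct K H m'" "\<forall>v\<in>pverts H. m' v = 3 * m v + p v" by blast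
  show ?case
    by (intro exI conjI, rule cw_construct.disjoint_union[OF l'(1) m'(1) disjoint_union.hyps(3)])
      (use l'(2) m'(2) in auto)
next
  case (join G l i j)
  then obtain l' where l': "cw_construct K G l'" "\<forall>v\<in>pverts G. l' v = 3 * l v + p v" by blast
  define J where "J = {3 * i..<3 * i + 3} \<times> {3 * j..<3 * j + 3}"
  have J: "finite J" "\<And>a b. (a, b) \<in> J \<Longrightarrow> a < K \<and> b < K \<and> a \<noteq> b"
    using join.hyps assms(2) by (auto simp: J_def)
  have mem: "l' v \<in> {3 * c..<3 * c + 3} \<longleftrightarrow> l v = c" if "v \<in> pverts G" for v c
    using l'(2) that assms(3)[of v] by (auto; presburger)
  have "parcs G \<union> {(u, v). u \<in> pverts G \<and> v \<in> pverts G \<and> ((l' u, l' v) \<in> J \<or> (l' v, l' u) \<in> J)} =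
    parcs G \<union> {(u, v). u \<in> pverts G \<and> v \<in> pverts G \<and> (l u = i \<and> l v = j \<or> l u = j \<and> l v = i)}"
    unfolding J_def mem_Times_iff fst_conv snd_conv using mem by blast
  with cw_construct_joins[OF J(1) l'(1) J(2)] l'(2) show ?case by auto
next
  case (relabel G l i j)
  then obtain l' where l': "cw_construct K G l'" "\<forall>v\<in>pverts G. l' v = 3 * l v + p v" by blast
  show ?case
  proof (cases "i = j")
    \<comment> \<open>For \<open>i = j\<close> the two blocks of refined labels coincide, which
      \<open>cw_construct_relabels\<close> excludes; the operation is then the identity.\<close>
    case True
    then show ?thesis using l' by auto
  next
    case False
    define I where "I = {3 * i..<3 * i + 3}"
    define f where "f a = 3 * j + (a - 3 * i)" for a
    have "cw_construct K G (\<lambda>v. if l' v \<in> I then f (l' v) else l' v)"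
      by (rule cw_construct_relabels[OF _ l'(1)]) (use relabel.hyps assms(2) False in \<open>auto simp: I_def f_def\<close>)
    moreover have "(if l' v \<in> I then f (l' v) else l' v) = 3 * (if l v = i then j else l v) + p v"
      if "v \<in> pverts G" for v
      using l'(2) that assms(3)[of v] by (auto simp: I_def f_def; presburger)
    ultimately show ?thesis by blast
  qed
qed

text \<open>The labels below \<open>3 * k\<close> build a single slice.  The vertices of the next slice and of the later
  ones get the label of their part shifted by \<open>3 * k + 3\<close> and \<open>3 * k\<close>, respectively.\<close>

lemma cw_construct_slices:
  assumes G: "pair_graph G" and p: "\<And>v. p v < 3"
    and "Ss \<noteq> []" "sorted_wrt (slice_before G p) Ss" "\<And>S. S \<in> set Ss \<Longrightarrow> \<exists>l. cw_construct k (induced_on G S) l"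
  shows "\<exists>l. cw_construct (3 * k + 6) (induced_on G (\<Union>(set Ss))) l \<and> (\<forall>v\<in>\<Union>(set Ss). l v = 3 * k + p v)"
  using assms(3-)
proof (induction Ss rule: list_nonempty_induct)
  \<comment> \<open>Once a slice is built with refined labels, only the part of each vertex is kept,
    as an offset in the block starting at \<open>3 * k + c\<close>. The last slice, where the
    construction starts, takes \<open>c = 0\<close>; a slice added in front takes
    \<open>c = 3\<close>.\<close>
  have collapse: "\<exists>l. cw_construct (3 * k + 6) (induced_on G S) l \<and> (\<forall>v\<in>S. l v = 3 * k + c + p v)"
    if ex: "\<exists>l. cw_construct k (induced_on G S) l" and c: "c \<le> 3" for S c
  proof -
    obtain l where l: "cw_construct (3 * k + 6) (induced_on G S) l" "\<forall>v\<in>S. l v < 3 * k \<and> l v mod 3 = p v"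
    proof -
      obtain l0 where l0: "cw_construct k (induced_on G S) l0" using ex by blast
      obtain l' where "cw_construct (3 * k + 6) (induced_on G S) l'" "\<forall>v\<in>S. l' v = 3 * l0 v + p v"
        using cw_construct_refine[where p = p, OF l0 _ p, of "3 * k + 6"] by auto
      moreover have "3 * l0 v + p v < 3 * k" if "v \<in> S" for v
        using cw_construct_label_less[OF l0, of v] that p[of v] by simp
      ultimately show thesis using that[of l'] p by simp
    qed
    have "cw_construct (3 * k + 6) (induced_on G S)
      (\<lambda>v. if l v \<in> {..<3 * k} then 3 * k + c + l v mod 3 else l v)"
    proof (rule cw_construct_relabels[OF _ l(1)])
      show "i < 3 * k + 6 \<and> 3 * k + c + i mod 3 < 3 * k + 6 \<and> 3 * k + c + i mod 3 \<notin> {..<3 * k}"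
        if "i \<in> {..<3 * k}" for i
        using that c mod_less_divisor[of 3 i] by simp
    qed simp
    moreover have "(if l v \<in> {..<3 * k} then 3 * k + c + l v mod 3 else l v) = 3 * k + c + p v"
      if "v \<in> S" for v using that l(2) by simp
    ultimately show ?thesis by blast
  qed
  {
    case (single S)
    then show ?case using collapse[of S 0] by simp
  next
    case (cons S Ss)
    let ?A = "\<Union>(set Ss)" and ?K = "3 * k + 6"
    obtain m where m: "cw_construct ?K (induced_on G ?A) m" "\<forall>v\<in>?A. m v = 3 * k + p v"
      using cons by auto
    obtain l where l: "cw_construct ?K (induced_on G S) l" "\<forall>v\<in>S. l v = 3 * k + 3 + p v"
      using cons.prems collapse[of S 3] by auto
    have before: "slice_before G p S ?A" using cons.prems by (auto simp: slice_before_def)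
    then have disj: "S \<inter> ?A = {}" by (simp add: slice_before_def)
    define n where "n v = (if v \<in> S then l v else m v)" for v
    have n: "n v = 3 * k + 3 + p v" if "v \<in> S" for v using that l by (simp add: n_def)
    have n': "n v = 3 * k + p v" if "v \<in> ?A" for v using that m disj by (auto simp: n_def)
    \<comment> \<open>By \<open>slice_before\<close>, the vertices of part \<open>c\<close> in the
      later slices are adjacent to exactly the vertices of \<open>S\<close> in part
      \<open>(c + 1) mod 3\<close>.\<close>
    define J where "J = (\<lambda>c. (3 * k + 3 + (c + 1) mod 3, 3 * k + c)) ` {..<3}"
    define E where "E = parcs G \<inter> S \<times> S \<union> parcs G \<inter> ?A \<times> ?A \<union>
      {(u, v). u \<in> S \<union> ?A \<and> v \<in> S \<union> ?A \<and> ((n u, n v) \<in> J \<or> (n v, n u) \<in> J)}"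
    have union: "cw_construct ?K \<lparr>pverts = S \<union> ?A, parcs = parcs G \<inter> S \<times> S \<union> parcs G \<inter> ?A \<times> ?A\<rparr> n"
      using disjoint_union[OF l(1) m(1)] disj by (simp add: n_def[abs_def])
    have mem_J: "(a, b) \<in> J \<longleftrightarrow> (\<exists>c<3. a = 3 * k + 3 + (c + 1) mod 3 \<and> b = 3 * k + c)" for a b
      by (simp add: J_def image_iff Bex_def)
    have J_less: "a < ?K \<and> b < ?K \<and> a \<noteq> b" if "(a, b) \<in> J" for a b
    proof -
      obtain c d where "c < 3" "d < 3" "a = 3 * k + 3 + d" "b = 3 * k + c"
        using \<open>(a, b) \<in> J\<close> mem_J mod_less_divisor[OF zero_less_numeral] by blast
      then show ?thesis by linarith
    qed
    have "finite J" by (simp add: J_def)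
    from cw_construct_joins[OF this union J_less]
    have constr: "cw_construct ?K \<lparr>pverts = S \<union> ?A, parcs = E\<rparr> n" by (simp add: E_def)
    \<comment> \<open>The two blocks of labels are disjoint, so the joins add no edge inside
      \<open>S\<close> or inside \<open>?A\<close>.\<close>
    have J_SA: "(n u, n v) \<in> J \<longleftrightarrow> u \<in> S \<and> v \<in> ?A \<and> p u = (p v + 1) mod 3"
      if uv: "u \<in> S \<union> ?A" "v \<in> S \<union> ?A" for u v
    proof
      assume "(n u, n v) \<in> J"
      then obtain c where c: "c < 3" "n u = 3 * k + 3 + (c + 1) mod 3" "n v = 3 * k + c"
        unfolding mem_J by blast
      have u: "u \<in> S" using c(2) uv(1) n'[of u] p[of u] by (cases "u \<in> S") auto
      have v: "v \<notin> S" using c(1,3) n[of v] by auto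
      then have "v \<in> ?A" using uv(2) by blast
      then show "u \<in> S \<and> v \<in> ?A \<and> p u = (p v + 1) mod 3"
        using u c n[OF u] n'[of v] by simp
    next
      assume a: "u \<in> S \<and> v \<in> ?A \<and> p u = (p v + 1) mod 3"
      then have "n u = 3 * k + 3 + (p v + 1) mod 3" "n v = 3 * k + p v" using n n' by auto
      then show "(n u, n v) \<in> J" unfolding mem_J using p by blast
    qed
    have cross: "(u, v) \<in> parcs G \<longleftrightarrow> (n u, n v) \<in> J" "(v, u) \<in> parcs G \<longleftrightarrow> (n u, n v) \<in> J"
      if uv: "u \<in> S" "v \<in> ?A" for u v
    proof -
      have "(u, v) \<in> parcs G \<longleftrightarrow> p u = (p v + 1) mod 3"
        using before uv unfolding slice_before_def by blast
      then show "(u, v) \<in> parcs G \<longleftrightarrow> (n u, n v) \<in> J" using J_SA[of u v] uv by blast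
      then show "(v, u) \<in> parcs G \<longleftrightarrow> (n u, n v) \<in> J" using pair_graph_arc_sym[OF G, of u v] by blast
    qed
    have "(u, v) \<in> E \<longleftrightarrow> (u, v) \<in> parcs G \<inter> (S \<union> ?A) \<times> (S \<union> ?A)" for u v
    proof -
      consider "u \<in> S" "v \<in> S" | "u \<in> S" "v \<in> ?A" | "u \<in> ?A" "v \<in> S" | "u \<in> ?A" "v \<in> ?A"
        | "u \<notin> S \<union> ?A \<or> v \<notin> S \<union> ?A" by blast
      then show ?thesis
      proof cases
        case 1
        then show ?thesis using J_SA[of u v] J_SA[of v u] disj unfolding E_def by blast
      next
        case 2
        then show ?thesis using J_SA[of v u] cross[of u v] disj unfolding E_def by blast
      next
        case 3
        then show ?thesis using J_SA[of u v] cross[of v u] disj unfolding E_def by blast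
      next
        case 4
        then show ?thesis using J_SA[of u v] J_SA[of v u] disj unfolding E_def by blast
      next
        case 5
        then show ?thesis unfolding E_def by blast
      qed
    qed
    then have "E = parcs G \<inter> (S \<union> ?A) \<times> (S \<union> ?A)" by auto
    then have constr': "cw_construct ?K (induced_on G (\<Union>(set (S # Ss)))) n"
      using constr by (simp add: induced_on_def)
    \<comment> \<open>Merging the upper block into the lower one restores the invariant and frees
      the upper block for the next slice.\<close>
    have "cw_construct ?K (induced_on G (\<Union>(set (S # Ss))))
      (\<lambda>v. if n v \<in> {3 * k + 3..<3 * k + 6} then n v - 3 else n v)"
      by (rule cw_construct_relabels[OF _ constr']) auto
    moreover have "(if n v \<in> {3 * k + 3..<3 * k + 6} then n v - 3 else n v) = 3 * k + p v"
      if "v \<in> S \<union> ?A" for v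
      using that n[of v] n'[of v] p[of v] by (cases "v \<in> S") simp_all
    ultimately show ?case by auto
  }
qed

section \<open>Transfer of the clique-width bound\<close>

lemma clique_width_le_iff:
  assumes "pair_graph G" "pverts G \<noteq> {}"
  shows "clique_width G \<le> k \<longleftrightarrow> (\<exists>l. cw_construct k G l)"
proof
  \<comment> \<open>By \<open>ex_cw_construct\<close> some number of labels suffices, so the least
    one is attained.\<close>
  have "\<exists>l. cw_construct (clique_width G) G l"
    using ex_cw_construct[OF assms] assms(2) by (auto simp: clique_width_def intro: LeastI)
  then show "\<exists>l. cw_construct k G l" if "clique_width G \<le> k"
    using that cw_construct_mono by blast
  show "clique_width G \<le> k" if "\<exists>l. cw_construct k G l"
    using that assms(2) by (auto simp: clique_width_def intro: Least_le)
qed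

lemma bounded_clique_width_curious:
  assumes X: "graph_class X" "hereditary X" and "bounded_clique_width {G \<in> X. bipartite G}"
  shows "bounded_clique_width {G \<in> X. curious G}"
proof -
  have pg: "pair_graph H" if "H \<in> X" for H using X(1) that by (simp add: graph_class_def)
  obtain k where k: "\<And>G. G \<in> X \<Longrightarrow> bipartite G \<Longrightarrow> clique_width G \<le> k"
    using assms(3) by (auto simp: bounded_clique_width_def)
  have "clique_width G \<le> 3 * k + 6" if G: "G \<in> X" "curious G" for G
  proof (cases "pverts G = {}")
    case True
    then show ?thesis by (simp add: clique_width_def)
  next
    case False
    obtain p Ss where p: "\<And>v. p v < 3" and Ss: "\<Union>(set Ss) = pverts G"
      "\<And>S. S \<in> set Ss \<Longrightarrow> S \<noteq> {} \<and> bipartite (induced_on G S)" "sorted_wrt (slice_before G p) Ss"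
      using curious_slicing[OF pg[OF G(1)] G(2)] by metis
    have "\<exists>l. cw_construct k (induced_on G S) l" if S: "S \<in> set Ss" for S
    proof -
      have "S \<subseteq> pverts G" using Ss(1) S by blast
      then have IX: "induced_on G S \<in> X" by (rule hereditary_induced_on[OF X G(1)])
      have "clique_width (induced_on G S) \<le> k" using k[OF IX] Ss(2)[OF S] by blast
      \<comment> \<open>A construction exists only for graphs with vertices; slices are
        nonempty.\<close>
      then show ?thesis using clique_width_le_iff[OF pg[OF IX]] Ss(2)[OF S] by simp
    qed
    moreover have "Ss \<noteq> []" using Ss(1) False by auto
    ultimately have "\<exists>l. cw_construct (3 * k + 6) (induced_on G (\<Union>(set Ss))) l"
      using cw_construct_slices[OF pg[OF G(1)] p _ Ss(3)] by blast
    then show ?thesis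
      using clique_width_le_iff[OF pg[OF G(1)] False] Ss(1) induced_on_pverts[OF pg[OF G(1)]] by simp
  qed
  then show ?thesis by (auto simp: bounded_clique_width_def)
qed

theorem theorem4:
  fixes X :: "'a pair_pre_digraph set"
  assumes "graph_class X" and "hereditary X"
  shows "(labelled_wqo TYPE(nat) {G \<in> X. bipartite G} \<longrightarrow>
            labelled_wqo TYPE('w) {G \<in> X. curious G}) \<and>
         (bounded_clique_width {G \<in> X. bipartite G} \<longrightarrow>
            bounded_clique_width {G \<in> X. curious G})"
  using labelled_wqo_curious[OF assms] bounded_clique_width_curious[OF assms] by blast

end
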